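(* Let $\Sigma=\{\mathtt{a},\mathtt{b}\}$. For the truncation map $\iota^\infty:\Sigma^\infty\to\widetilde{\Sigma}^*$ one has $\iota^\infty(\Sigma^\infty)\subsetneq\widetilde{\Sigma}^*$. In particular, the truncation injection $\iota^\infty:\Sigma^\infty\hookrightarrow\widetilde{\Sigma}^*$ is not surjective.
   Context: $\Sigma^*$ is the free monoid of finite words over $\Sigma$ under concatenation, $\lambda$ is the empty word, $|w|$ is the length of $w$; $\Sigma^\omega$ is the set of right-infinite words $u=u_1u_2\cdots$ and $\Sigma^\infty=\Sigma^*\cup\Sigma^\omega$. For $u\neq v$ in $\Sigma^*$, $\operatorname{lcp}(u,v)$ and $\operatorname{lcs}(u,v)$ are the lengths of the longest common prefix and of the longest common suffix of $u,v$; by convention $\operatorname{lcp}(u,u)=\operatorname{lcs}(u,u)=+\infty$. A net of words is a family $(w_\varepsilon)_{\varepsilon\in(0,1]}$ of words in $\Sigma^*$. It is moderate if there exist $N\in\mathbb{N}$, $C>0$, $\varepsilon_0>0$ with $|w_\varepsilon|\le C\varepsilon^{-N}$ for all $\varepsilon<\varepsilon_0$. $\mathcal{E}_M(\Sigma^* )$ is the set of moderate nets. Two moderate nets are equivalent, $(u_\varepsilon)\sim(v_\varepsilon)$, if for every $m\in\mathbb{N}$ there exists $\varepsilon_0>0$ such that $\min\{\operatorname{lcp}(u_\varepsilon,v_\varepsilon),\operatorname{lcs}(u_\varepsilon,v_\varepsilon)\}\ge m\log_2(1/\varepsilon)$ for all $\varepsilon<\varepsilon_0$; this is an equivalence relation.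 $\widetilde{\Sigma}^*:=\mathcal{E}_M(\Sigma^* )/\sim$, with classes written $[(w_\varepsilon)]$. The truncation map $\iota^\infty:\Sigma^\infty\to\widetilde{\Sigma}^*$ is defined by: $\iota^\infty(u)=[(u)_\varepsilon]$ (class of the constant net) for $u\in\Sigma^*$, and $\iota^\infty(u)=[(u_1u_2\cdots u_{\lfloor 1/\varepsilon\rfloor})_\varepsilon]$ for $u=u_1u_2\cdots\in\Sigma^\omega$. This map is injective. *)

theory Defs
  imports
    "HOL-Analysis.Analysis"
    "HOL-Library.Sublist"
    "HOL-Library.Stream"
begin

definition lcp :: "'a list \<Rightarrow> 'a list \<Rightarrow> ereal" where
  "lcp u v = (if u = v then \<infinity> else ereal (real (length (longest_common_prefix u v))))"

definition lcs :: "'a list \<Rightarrow> 'a list \<Rightarrow> ereal" where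
  "lcs u v = (if u = v then \<infinity> else ereal (real (Max {length s | s. suffix s u \<and> suffix s v})))"

text \<open>
  Families indexed by \<open>(0,1]\<close> are represented extensionally (value \<open>undefined\<close> off the
  index set), so that equality of nets is equality of families.
\<close>

type_synonym 'a net = "real \<Rightarrow> 'a list"

definition moderate_nets :: "'a net set" where
  "moderate_nets =
     {w \<in> {0<..1} \<rightarrow>\<^sub>E UNIV.
        \<exists>(N::nat) C \<epsilon>\<^sub>0. C > 0 \<and> \<epsilon>\<^sub>0 > 0 \<and>
          (\<forall>\<epsilon>\<in>{0<..1}. \<epsilon> < \<epsilon>\<^sub>0 \<longrightarrow> real (length (w \<epsilon>)) \<le> C * \<epsilon> powr (- real N))}"

definition net_equiv :: "('a net \<times> 'a net) set" where
  "net_equiv =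
     {(u, v). u \<in> moderate_nets \<and> v \<in> moderate_nets \<and>
        (\<forall>m::nat. \<exists>\<epsilon>\<^sub>0>0. \<forall>\<epsilon>\<in>{0<..1}. \<epsilon> < \<epsilon>\<^sub>0 \<longrightarrow>
           min (lcp (u \<epsilon>) (v \<epsilon>)) (lcs (u \<epsilon>) (v \<epsilon>)) \<ge> ereal (real m * log 2 (1 / \<epsilon>)))}"

definition net_class :: "'a net \<Rightarrow> 'a net set" where
  "net_class w = net_equiv `` {w}"

definition generalized_words :: "'a net set set" where
  "generalized_words = moderate_nets // net_equiv"

datatype 'a fin_inf_word = Finite_Word "'a list" | Infinite_Word "'a stream"

primrec truncation_net :: "'a fin_inf_word \<Rightarrow> 'a net" where
  "truncation_net (Finite_Word u) = (\<lambda>\<epsilon>\<in>{0<..1}. u)"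
| "truncation_net (Infinite_Word u) = (\<lambda>\<epsilon>\<in>{0<..1}. stake (nat \<lfloor>1 / \<epsilon>\<rfloor>) u)"

definition truncation :: "'a fin_inf_word \<Rightarrow> 'a net set" where
  "truncation u = net_class (truncation_net u)"

datatype letter = Letter_a | Letter_b

end

theory Submission
  imports Defs
begin

text \<open>
  All three claims rest on one observation about prefixes. Since \<open>log 2 (1 / \<epsilon>)\<close> tends to
  infinity as \<open>\<epsilon>\<close> tends to \<open>0\<close>, equivalent nets have, for every fixed \<open>K\<close>, the same first
  \<open>K\<close> letters for all small \<open>\<epsilon>\<close> (\<open>net_equiv_imp_eventually_take_eq\<close>). On the other hand the
  first \<open>K\<close> letters of the truncation net of a word \<open>x\<close> are, for all small \<open>\<epsilon>\<close>, the first \<open>K\<close>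
  letters of \<open>x\<close> itself (\<open>eventually_take_truncation_net\<close>).

  Injectivity follows because a finite or infinite word is determined by its prefixes. For
  non-surjectivity it suffices to exhibit a moderate net whose first letter does not stabilise
  as \<open>\<epsilon>\<close> tends to \<open>0\<close>: the one-letter net that takes one value when \<open>1 / \<epsilon>\<close> is an integer and
  a different value otherwise. Such a net is equivalent to no truncation net.
\<close>

lemma lcp_ge_imp_take_eq:
  assumes "ereal (real K) \<le> lcp u v"
  shows "take K u = take K v"
proof (cases "u = v")
  case False
  define p where "p = longest_common_prefix u v"
  have "K \<le> length p"
    using assms False by (simp add: lcp_def p_def)
  moreover have "prefix p u" "prefix p v"
    by (simp_all add: p_def longest_common_prefix_prefix1 longest_common_prefix_prefix2)
  ultimately show ?thesis
    by (auto simp: prefix_def)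
qed simp

lemma net_equiv_imp_eventually_take_eq:
  assumes "(u, v) \<in> net_equiv"
  shows "\<forall>\<^sub>F \<epsilon> in at_right 0. take K (u \<epsilon>) = take K (v \<epsilon>)"
proof -
  from assms obtain \<epsilon>\<^sub>0 where "\<epsilon>\<^sub>0 > 0" and close:
    "\<And>\<epsilon>. \<epsilon> \<in> {0<..1} \<Longrightarrow> \<epsilon> < \<epsilon>\<^sub>0 \<Longrightarrow>
       ereal (real K * log 2 (1 / \<epsilon>)) \<le> min (lcp (u \<epsilon>) (v \<epsilon>)) (lcs (u \<epsilon>) (v \<epsilon>))"
    unfolding net_equiv_def by blast
  have "take K (u \<epsilon>) = take K (v \<epsilon>)" if "0 < \<epsilon>" "\<epsilon> < min \<epsilon>\<^sub>0 (1/2)" for \<epsilon>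
  proof (rule lcp_ge_imp_take_eq)
    \<comment> \<open>Below \<open>1/2\<close> the logarithm is at least \<open>1\<close>, so the exponent \<open>m = K\<close> already gives a
       common prefix of length \<open>K\<close>.\<close>
    have "1 \<le> log 2 (1 / \<epsilon>)"
      using that by (simp add: le_log_iff field_simps)
    then have "real K \<le> real K * log 2 (1 / \<epsilon>)"
      by (simp add: mult_le_cancel_left1)
    then have "ereal (real K) \<le> ereal (real K * log 2 (1 / \<epsilon>))"
      by simp
    also have "\<dots> \<le> lcp (u \<epsilon>) (v \<epsilon>)"
      using close[of \<epsilon>] that by simp
    finally show "ereal (real K) \<le> lcp (u \<epsilon>) (v \<epsilon>)" .
  qed
  with \<open>\<epsilon>\<^sub>0 > 0\<close> show ?thesis
    by (auto simp: eventually_at_right_field intro!: exI[of _ "min \<epsilon>\<^sub>0 (1/2)"])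
qed

primrec take_word :: "nat \<Rightarrow> 'a fin_inf_word \<Rightarrow> 'a list" where
  "take_word K (Finite_Word u) = take K u"
| "take_word K (Infinite_Word s) = stake K s"

text \<open>
  A prefix that is one letter longer than a finite word separates it from every infinite word;
  two infinite words are compared letter by letter.
\<close>

lemma fin_inf_word_eqI:
  assumes "\<And>K. take_word K x = take_word K y"
  shows "x = y"
proof (cases x; cases y)
  fix u v assume "x = Finite_Word u" "y = Finite_Word v"
  then show ?thesis
    using assms[of "max (length u) (length v)"] by simp
next
  fix u s assume "x = Finite_Word u" "y = Infinite_Word s"
  then show ?thesis
    using arg_cong[OF assms[of "Suc (length u)"], of length] by simp
next
  fix s u assume "x = Infinite_Word s" "y = Finite_Word u"
  then show ?thesis
    using arg_cong[OF assms[of "Suc (length u)"], of length] by simp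
next
  fix s t assume xy: "x = Infinite_Word s" "y = Infinite_Word t"
  have "s !! n = t !! n" for n
    using assms[of "Suc n"] xy by (metis lessI stake_nth take_word.simps(2))
  then have "(!!) s = (!!) t"
    by (rule ext)
  then have "s = t"
    using stream_smap_nats[of s] stream_smap_nats[of t] by metis
  then show ?thesis
    using xy by blast
qed

text \<open>
  The truncation length \<open>\<lfloor>1 / \<epsilon>\<rfloor>\<close> eventually exceeds any \<open>K\<close>, so truncating does not touch the
  first \<open>K\<close> letters.
\<close>

lemma eventually_take_truncation_net:
  "\<forall>\<^sub>F \<epsilon> in at_right 0. take K (truncation_net x \<epsilon>) = take_word K x"
proof -
  have "take K (truncation_net x \<epsilon>) = take_word K x"
    if "0 < \<epsilon>" "\<epsilon> < 1 / real (Suc K)" for \<epsilon>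
  proof -
    have "real K \<le> 1 / \<epsilon>"
      using that by (simp add: field_simps)
    then have "K \<le> nat \<lfloor>1 / \<epsilon>\<rfloor>"
      by (simp add: le_nat_floor)
    moreover have "1 / real (Suc K) \<le> 1"
      by simp
    then have "\<epsilon> \<in> {0<..1}"
      using that unfolding greaterThanAtMost_iff by linarith
    ultimately show ?thesis
      by (cases x) (simp_all add: take_stake min_def)
  qed
  then show ?thesis
    by (auto simp: eventually_at_right_field intro!: exI[of _ "1 / real (Suc K)"])
qed

lemma bounded_net_moderate:
  assumes "w \<in> {0<..1} \<rightarrow>\<^sub>E UNIV" and "\<And>\<epsilon>. \<epsilon> \<in> {0<..1} \<Longrightarrow> length (w \<epsilon>) \<le> L"
  shows "w \<in> moderate_nets"
proof -
  have "real (length (w \<epsilon>)) \<le> (real L + 1) * \<epsilon> powr (- real 0)" if "\<epsilon> \<in> {0<..1}" for \<epsilon>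
    using assms(2)[OF that] that by simp
  moreover have "real L + 1 > 0" "(1::real) > 0"
    by simp_all
  ultimately show ?thesis
    using assms(1) unfolding moderate_nets_def by blast
qed

lemma truncation_net_moderate: "truncation_net x \<in> moderate_nets"
proof (cases x)
  case (Finite_Word u)
  then show ?thesis
    by (auto intro!: bounded_net_moderate[of _ "length u"])
next
  case (Infinite_Word s)
  have "real (length (truncation_net x \<epsilon>)) \<le> 1 * \<epsilon> powr (- real 1)" if "\<epsilon> \<in> {0<..1}" for \<epsilon>
    using that Infinite_Word by (simp add: powr_minus_divide)
  moreover have "truncation_net x \<in> {0<..1} \<rightarrow>\<^sub>E UNIV"
    using Infinite_Word by simp
  moreover have "(1::real) > 0"
    by simp
  ultimately show ?thesis
    unfolding moderate_nets_def by blast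
qed

lemma net_equiv_refl:
  assumes "w \<in> moderate_nets"
  shows "(w, w) \<in> net_equiv"
  using assms by (auto simp: net_equiv_def lcp_def lcs_def intro: exI[of _ 1])

lemma net_class_eq_imp_net_equiv:
  assumes "net_class u = net_class v" and "v \<in> moderate_nets"
  shows "(u, v) \<in> net_equiv"
  using assms net_equiv_refl[of v] by (auto simp: net_class_def)

lemma inj_truncation: "inj truncation"
proof (rule injI)
  fix x y :: "'a fin_inf_word"
  assume "truncation x = truncation y"
  then have equiv: "(truncation_net x, truncation_net y) \<in> net_equiv"
    by (simp add: truncation_def net_class_eq_imp_net_equiv truncation_net_moderate)
  show "x = y"
  proof (rule fin_inf_word_eqI)
    fix K
    have "\<forall>\<^sub>F \<epsilon> in at_right (0::real). take_word K x = take_word K y"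
      using net_equiv_imp_eventually_take_eq[OF equiv, of K]
        eventually_take_truncation_net[of K x] eventually_take_truncation_net[of K y]
      by eventually_elim simp
    then show "take_word K x = take_word K y"
      by simp
  qed
qed

definition oscillating_net :: "'a \<Rightarrow> 'a \<Rightarrow> 'a net" where
  "oscillating_net a b = (\<lambda>\<epsilon>\<in>{0<..1}. if 1 / \<epsilon> \<in> \<int> then [a] else [b])"

lemma oscillating_net_moderate: "oscillating_net a b \<in> moderate_nets"
  by (rule bounded_net_moderate[of _ 1]) (auto simp: oscillating_net_def)

lemma oscillating_net_not_eventually_const:
  assumes "a \<noteq> b"
  shows "\<not> (\<forall>\<^sub>F \<epsilon> in at_right 0. take 1 (oscillating_net a b \<epsilon>) = c)"
proof
  assume "\<forall>\<^sub>F \<epsilon> in at_right 0. take 1 (oscillating_net a b \<epsilon>) = c"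
  then obtain \<delta> where "\<delta> > 0"
    and const: "\<And>\<epsilon>. 0 < \<epsilon> \<Longrightarrow> \<epsilon> < \<delta> \<Longrightarrow> take 1 (oscillating_net a b \<epsilon>) = c"
    by (auto simp: eventually_at_right_field)
  obtain n where "inverse (real (Suc n)) < \<delta>"
    using reals_Archimedean[OF \<open>\<delta> > 0\<close>] by blast
  \<comment> \<open>Two parameters below \<open>\<delta>\<close>: the reciprocals of an integer and of a half-integer.\<close>
  define q where "q = real (Suc n)"
  have q: "q \<in> \<int>" "1 \<le> q"
    unfolding q_def by (rule Ints_of_nat) simp
  have n: "1 / q < \<delta>"
    using \<open>inverse (real (Suc n)) < \<delta>\<close> unfolding q_def inverse_eq_divide .
  define r where "r = q + 1/2"
  have r: "r \<notin> \<int>"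
  proof
    assume "r \<in> \<int>"
    then obtain k :: int where "r = of_int k"
      by (auto elim: Ints_cases)
    then have "real_of_int (2 * k) = real_of_int (2 * int n + 3)"
      by (simp add: r_def q_def)
    then have "2 * k = 2 * int n + 3"
      by (simp only: of_int_eq_iff)
    then show False
      by presburger
  qed
  have "1 / r \<le> 1 / q"
    using q by (simp add: r_def field_simps)
  then have "1 / r < \<delta>" "0 < 1 / r" "1 / r \<le> 1"
    using n q by (simp_all add: r_def)
  then have "c = [b]"
    using const[of "1 / r"] r by (simp add: oscillating_net_def)
  moreover have "c = [a]"
    using const[of "1 / q"] n q by (simp add: oscillating_net_def)
  ultimately show False
    using assms by simp
qed

lemma truncation_neq_oscillating_class:
  assumes "a \<noteq> b"
  shows "truncation x \<noteq> net_class (oscillating_net a b)"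
proof
  assume "truncation x = net_class (oscillating_net a b)"
  then have "(truncation_net x, oscillating_net a b) \<in> net_equiv"
    by (simp add: truncation_def net_class_eq_imp_net_equiv oscillating_net_moderate)
  from net_equiv_imp_eventually_take_eq[OF this, of 1] eventually_take_truncation_net[of 1 x]
  have "\<forall>\<^sub>F \<epsilon> in at_right 0. take 1 (oscillating_net a b \<epsilon>) = take_word 1 x"
    by eventually_elim simp
  with oscillating_net_not_eventually_const[OF assms] show False
    by blast
qed

lemma net_class_in_generalized_words:
  "w \<in> moderate_nets \<Longrightarrow> net_class w \<in> generalized_words"
  by (simp add: net_class_def generalized_words_def quotientI)

theorem corollary4p4:
  shows "range (truncation :: letter fin_inf_word \<Rightarrow> letter net set) \<subset> generalized_words
    \<and> inj (truncation :: letter fin_inf_word \<Rightarrow> letter net set)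
    \<and> \<not> (\<forall>x \<in> (generalized_words :: letter net set set). \<exists>u. truncation u = x)"
proof -
  define X where "X = net_class (oscillating_net Letter_a Letter_b)"
  have X: "X \<in> generalized_words"
    by (simp add: X_def net_class_in_generalized_words oscillating_net_moderate)
  have not_trunc: "truncation u \<noteq> X" for u
    by (simp add: X_def truncation_neq_oscillating_class)
  have "range (truncation :: letter fin_inf_word \<Rightarrow> letter net set) \<subseteq> generalized_words"
    by (auto simp: truncation_def net_class_in_generalized_words truncation_net_moderate)
  moreover have "range (truncation :: letter fin_inf_word \<Rightarrow> letter net set) \<noteq> generalized_words"
    using X not_trunc by (metis rangeE)
  ultimately show ?thesis
    using X not_trunc inj_truncation by (intro conjI psubsetI) auto
qed

end
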